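(* Let $G=(V,E)$ be a directed graph with $V=\{1,\dots,N\}$ and $E\subseteq V^2$ (self-loops allowed), with labeled adjacency matrix $\mathsf W$, and let $\mathcal S$ be the set of all non-empty subsets of $V$ (including $V$). Let $\mathsf P_{\mathrm{op}}(z)$ and $\mathsf P_{\mathrm{cl}}(z)$ be the matrix generating series of the open simple paths and of the closed simple paths (simple cycles) of $G$, respectively. Then: (i) $$\mathsf P_{\mathrm{op}}(z)=\sum_{S\in\mathcal S}(z\mathsf W_S)^{|S|-1}(\mathsf I-z\mathsf W_S)^{N-|S|};$$ (ii) $$\mathsf P_{\mathrm{cl}}(z)=\sum_{S\in\mathcal S}\operatorname{Diag}\Big((z\mathsf W_S)^{|S|}(\mathsf I-z\mathsf W_S)^{N-|S|}\Big).$$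
   Context: Each arc $(i,j)\in E$ carries a label $\omega_{ij}$. The labeled adjacency matrix $\mathsf W$ is the $N\times N$ matrix with $\mathsf W_{ij}=\omega_{ij}$ if $(i,j)\in E$ and $\mathsf W_{ij}=0$ otherwise. $\mathsf I$ is the $N\times N$ identity matrix and $z$ is a formal variable. A path $p$ of length $\ell(p)=\ell\ge 1$ from $i$ to $j$ is a sequence of $\ell$ contiguous arcs (each new arc starts where the previous one ended), written $p=\omega_{ii_1}\omega_{i_1i_2}\cdots\omega_{i_{\ell-1}j}$. A path is open if its end vertices $i,j$ are different and closed (a cycle) otherwise. By convention, the empty path $1$ is considered a cycle of zero length. $V(p)$ is the set of vertices of $p$ and $|V(p)|$ its size. Simple paths are paths that do not visit the same vertex more than once (the start and end vertices of a closed path coinciding); they are characterized as the non-empty paths $p$ such that $\ell(p)=|V(p)|-1$ if $p$ is open and $\ell(p)=|V(p)|$ if $p$ is closed. In particular self-loops $\omega_{ii}$ and backtracks $\omega_{ij}\omega_{ji}$ are cycles of length $1$ and $2$. $\mathsf P(z)$ is the $N\times N$ matrix with entries $\mathsf P_{ij}(z)=\sum_{p:\,i\to j,\ p\text{ simple}}p\,z^{\ell(p)}$. For a square matrix $\mathsf M$, $\operatorname{Diag}(\mathsf M)$ is the diagonal matrix obtained by setting all off-diagonal entries of $\mathsf M$ to zero. Set $\mathsf P_{\mathrm{cl}}(z)=\operatorname{Diag}(\mathsf P(z))$ and $\mathsf P_{\mathrm{op}}(z)=\mathsf P(z)-\mathsf P_{\mathrm{cl}}(z)$. For an $N\times N$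 matrix $\mathsf M$ and $S\in\mathcal S$, $\mathsf M_S$ is the $N\times N$ matrix with $(\mathsf M_S)_{ij}=\mathsf M_{ij}$ if $i,j\in S$ and $0$ otherwise.
   Formalization: Formula (i) fails on the diagonal (for N=1 the left side is 0, the right side is I); the formal version subtracts N times the identity from the right side of (i), with zeroth powers equal to I. Off-diagonal entries of (i), and all of (ii), are unchanged. *)

theory Defs
  imports
    "HOL-Analysis.Finite_Cartesian_Product"
    "HOL-Computational_Algebra.Formal_Power_Series"
    "Graph_Theory.Pair_Digraph"
begin

unbundle no fps_syntax

text \<open>
  The vertex set of the graph is the whole (finite) index type, so \<open>N = CARD('n)\<close>, and the
  graph is determined by its set \<open>E\<close> of arcs. The labels lie in an arbitrary, possibly
  noncommutative ring with unit; taking a free algebra and its generators gives the case of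
  formal labels, in which a path is the word formed by the labels of its arcs. Multiplication of
  \<open>fps\<close> makes the variable \<open>fps_X\<close> commute with all coefficients.
\<close>

definition graph :: "('n \<times> 'n) set \<Rightarrow> ('n, 'n \<times> 'n) pre_digraph" where
  "graph E = with_proj \<lparr>pverts = UNIV, parcs = E\<rparr>"

definition labeled_adjacency ::
    "('n \<times> 'n) set \<Rightarrow> ('n \<Rightarrow> 'n \<Rightarrow> 'a::zero) \<Rightarrow> 'a^'n^'n" where
  "labeled_adjacency E \<omega> = (\<chi> i j. if (i, j) \<in> E then \<omega> i j else 0)"

text \<open>
  An open path is simple iff it is an \<open>apath\<close> (no repeated vertex). A closed path is simple iff
  it is a \<open>cycle\<close>, i.e. nonempty and without repeated vertex except that its two ends coincide;
  loops and backtracks are cycles in this sense. The equivalent description by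
  the length and the number of vertices is \<open>simple_paths_iff_length\<close> below.
\<close>

definition simple_paths :: "('n \<times> 'n) set \<Rightarrow> 'n \<Rightarrow> 'n \<Rightarrow> ('n \<times> 'n) awalk set" where
  "simple_paths E i j =
    (if i \<noteq> j then {p. pre_digraph.apath (graph E) i p j}
     else {p. pre_digraph.awalk (graph E) i p i \<and> pre_digraph.cycle (graph E) p})"

definition path_label :: "('n \<Rightarrow> 'n \<Rightarrow> 'a::monoid_mult) \<Rightarrow> ('n \<times> 'n) awalk \<Rightarrow> 'a" where
  "path_label \<omega> p = prod_list (map (\<lambda>(i, j). \<omega> i j) p)"

definition simple_path_gf ::
    "('n \<times> 'n) set \<Rightarrow> ('n \<Rightarrow> 'n \<Rightarrow> 'a::semiring_1) \<Rightarrow> 'a fps^'n^'n" where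
  "simple_path_gf E \<omega> =
    (\<chi> i j. \<Sum>p\<in>simple_paths E i j. fps_const (path_label \<omega> p) * fps_X ^ length p)"

definition Diag :: "'a::zero^'n^'n \<Rightarrow> 'a^'n^'n" where
  "Diag M = (\<chi> i j. if i = j then M $ i $ j else 0)"

definition closed_simple_path_gf ::
    "('n \<times> 'n) set \<Rightarrow> ('n \<Rightarrow> 'n \<Rightarrow> 'a::semiring_1) \<Rightarrow> 'a fps^'n^'n" where
  "closed_simple_path_gf E \<omega> = Diag (simple_path_gf E \<omega>)"

definition open_simple_path_gf ::
    "('n \<times> 'n) set \<Rightarrow> ('n \<Rightarrow> 'n \<Rightarrow> 'a::ring_1) \<Rightarrow> 'a fps^'n^'n" where
  "open_simple_path_gf E \<omega> = simple_path_gf E \<omega> - closed_simple_path_gf E \<omega>"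

definition restrict_mat :: "'a::zero^'n^'n \<Rightarrow> 'n set \<Rightarrow> 'a^'n^'n" where
  "restrict_mat M S = (\<chi> i j. if i \<in> S \<and> j \<in> S then M $ i $ j else 0)"

definition z_times :: "'a::semiring_1^'n^'n \<Rightarrow> 'a fps^'n^'n" where
  "z_times M = (\<chi> i j. fps_X * fps_const (M $ i $ j))"

text \<open>
  Powers with respect to \<open>**\<close>; in particular \<open>mat_pow M 0\<close> is the full identity matrix, also when
  \<open>M\<close> is a restricted matrix.
\<close>

primrec mat_pow :: "'a::semiring_1^'n^'n \<Rightarrow> nat \<Rightarrow> 'a^'n^'n" where
  "mat_pow M 0 = mat 1"
| "mat_pow M (Suc k) = M ** mat_pow M k"

lemma length_pawalk_verts: "length (pawalk_verts i p) = Suc (length p)"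
  by (induction p arbitrary: i) auto

lemma hd_pawalk_verts: "pcas i p j \<Longrightarrow> hd (pawalk_verts i p) = i"
  by (cases p) auto

lemma last_pawalk_verts: "pcas i p j \<Longrightarrow> last (pawalk_verts i p) = j"
  by (induction p arbitrary: i) (auto simp: last_ConsR neq_Nil_conv length_pawalk_verts
      simp flip: length_0_conv)

lemma pcas_start_unique: "pcas i p j \<Longrightarrow> pcas k p l \<Longrightarrow> p \<noteq> [] \<Longrightarrow> k = i"
  by (cases p) auto

lemma simple_paths_iff_length:
  fixes E :: "('n \<times> 'n) set"
  shows "p \<in> simple_paths E i j \<longleftrightarrow>
    p \<noteq> [] \<and> pre_digraph.awalk (graph E) i p j \<and>
    length p =
      (let V = set (pre_digraph.awalk_verts (graph E) i p)
       in if i \<noteq> j then card V - 1 else card V)"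
proof -
  let ?vs = "pawalk_verts i p"
  note defs = simple_paths_def graph_def pre_digraph.apath_def pre_digraph.cycle_def
    pre_digraph.awalk_def cas_with_proj_eq awalk_verts_with_proj_eq with_proj_simps Let_def
  obtain ws where ws: "?vs = i # ws" if "pcas i p j"
    using hd_pawalk_verts[of i p j] length_pawalk_verts[of i p]
    by (cases ?vs) auto
  show ?thesis
  proof (cases "pcas i p j \<and> p \<noteq> []")
    case False
    then show ?thesis by (auto simp: defs dest: pcas_start_unique)
  next
    case True
    then have vs: "?vs = i # ws" and len: "length ws = length p" and lst: "last (i # ws) = j"
      using ws length_pawalk_verts[of i p] last_pawalk_verts[of i p j] by auto
    show ?thesis
    proof (cases "i = j")
      case neq: False
      have "distinct ?vs \<longleftrightarrow> card (set ?vs) = Suc (length p)"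
        using length_pawalk_verts[of i p] by (metis card_distinct distinct_card)
      moreover have "card (set ?vs) \<noteq> 0"
        by (simp add: vs)
      ultimately show ?thesis
        using True neq by (auto simp: defs simp del: distinct.simps)
    next
      case eq: True
      have "ws \<noteq> []" using True len by auto
      then have "i \<in> set ws" using lst eq by (auto dest: last_in_set)
      then have "set ?vs = set ws" by (auto simp: vs)
      then have "distinct (tl ?vs) \<longleftrightarrow> length p = card (set ?vs)"
        using len by (metis card_distinct distinct_card list.sel(3) vs)
      then show ?thesis
        using True eq by (auto simp: defs dest: pcas_start_unique)
    qed
  qed
qed

lemma finite_simple_paths:
  fixes E :: "('n::finite \<times> 'n) set"
  shows "finite (simple_paths E i j)"
proof (rule finite_subset)
  show "simple_paths E i j \<subseteq> {p. set p \<subseteq> UNIV \<and> length p \<le> CARD('n)}"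
  proof
    fix p assume "p \<in> simple_paths E i j"
    then have "length p \<le> card (set (pre_digraph.awalk_verts (graph E) i p))"
      by (auto simp: simple_paths_iff_length Let_def split: if_splits)
    also have "\<dots> \<le> CARD('n)" by (simp add: card_mono)
    finally show "p \<in> {p. set p \<subseteq> UNIV \<and> length p \<le> CARD('n)}" by simp
  qed
qed (rule finite_lists_length_le, simp)

text \<open>
  The singletons \<open>S\<close> contribute an identity matrix each to the sum of the terms
  \<open>(z W\<^sub>S)\<^bsup>|S| - 1\<^esup> (I - z W\<^sub>S)\<^bsup>N - |S|\<^esup>\<close>, because of the zeroth power, whereas the series of the
  open simple paths has zero diagonal. So this sum is not the series itself, as the case of a
  single vertex shows; the difference is \<open>N\<close> times the identity.
\<close>

lemma open_simple_path_gf_diagonal: "open_simple_path_gf E \<omega> $ i $ i = 0"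
  by (simp add: open_simple_path_gf_def closed_simple_path_gf_def Diag_def)

lemma open_simple_path_gf_ne_sum_unit:
  fixes E :: "(unit \<times> unit) set" and \<omega> :: "unit \<Rightarrow> unit \<Rightarrow> 'a::ring_1"
  shows "open_simple_path_gf E \<omega> \<noteq>
    (\<Sum>S | S \<noteq> {}.
       mat_pow (z_times (restrict_mat (labeled_adjacency E \<omega>) S)) (card S - 1) **
       mat_pow (mat 1 - z_times (restrict_mat (labeled_adjacency E \<omega>) S)) (CARD(unit) - card S))"
    (is "_ \<noteq> ?R")
proof
  assume "open_simple_path_gf E \<omega> = ?R"
  moreover have "{S :: unit set. S \<noteq> {}} = {UNIV}"
    by auto
  then have "?R = mat 1" by simp
  ultimately show False
    using open_simple_path_gf_diagonal[of E \<omega> "()"] by (simp add: mat_def)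
qed

end

theory Submission
  imports Defs
begin

text \<open>
  Expanding \<open>(I - A)\<^bsup>N - |S|\<^esup>\<close> over the subsets \<open>U\<close> of the complement of \<open>S\<close> and putting
  \<open>T = S \<union> U\<close> turns the right-hand sides into
  \<open>\<Sum>\<^sub>T \<Sum>\<^bsub>{} \<noteq> S \<subseteq> T\<^esub> (-1)\<^bsup>|T| - |S|\<^esup> (z W\<^sub>S)\<^bsup>|T| - d\<^esup>\<close> with \<open>d = 1\<close> for open and \<open>d = 0\<close> for closed
  paths. The entries of \<open>(z W\<^sub>S)\<^bsup>m\<^esup>\<close> enumerate the walks of length \<open>m\<close> inside \<open>S\<close>, so by Moebius
  inversion the inner sum enumerates the walks of length \<open>|T| - d\<close> with vertex set exactly \<open>T\<close>;
  these are the simple paths. The only exception is the exponent \<open>0\<close>, where \<open>(z W\<^sub>S)\<^bsup>0\<^esup>\<close> is the full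
  identity matrix although only the vertices in \<open>S\<close> have an empty walk inside \<open>S\<close>; this produces
  the correction \<open>N I\<close>.
\<close>

section \<open>Walks, and simple paths as walks of extremal length\<close>

definition walks :: "('n \<times> 'n) set \<Rightarrow> 'n \<Rightarrow> 'n \<Rightarrow> nat \<Rightarrow> ('n \<times> 'n) awalk set" where
  "walks E i j m = {p. set p \<subseteq> E \<and> pcas i p j \<and> length p = m}"

definition path_gf :: "('n \<Rightarrow> 'n \<Rightarrow> 'a::semiring_1) \<Rightarrow> ('n \<times> 'n) awalk \<Rightarrow> 'a fps" where
  "path_gf \<omega> p = fps_const (path_label \<omega> p) * fps_X ^ length p"

lemma finite_walks: "finite (walks (E :: ('n::finite \<times> 'n) set) i j m)"
proof (rule finite_subset)
  show "walks E i j m \<subseteq> {p. set p \<subseteq> UNIV \<and> length p = m}"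
    by (auto simp: walks_def)
qed (rule finite_lists_length_eq, simp)

lemma start_in_pawalk_verts: "pcas i p j \<Longrightarrow> i \<in> set (pawalk_verts i p)"
  by (cases p) auto

text \<open>Simplicity becomes a condition on length and vertex set alone, so simple paths can be
  sorted by their vertex set. In the closed case nonemptiness is implied, since the start vertex
  makes the required length positive.\<close>

lemma simple_paths_eq_walks:
  fixes E :: "('n \<times> 'n) set"
  shows "simple_paths E i j =
    {p. p \<in> walks E i j (card (set (pawalk_verts i p)) - (if i = j then 0 else 1))}"
proof -
  have "card (set (pawalk_verts i p)) \<noteq> 0" if "pcas i p j" for p
    using start_in_pawalk_verts[OF that] by auto
  then show ?thesis
    by (auto simp: simple_paths_iff_length walks_def graph_def pre_digraph.awalk_def
        cas_with_proj_eq awalk_verts_with_proj_eq with_proj_simps Let_def)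
qed

text \<open>The common end occurs twice among the \<open>length p + 1\<close> listed
  vertices.\<close>

lemma card_closed_walk_verts_le:
  assumes "pcas i p i" "p \<noteq> []"
  shows "card (set (pawalk_verts i p)) \<le> length p"
proof -
  have "\<not> distinct (pawalk_verts i p)"
    using assms last_pawalk_verts[of _ _ i]
    by (cases p) (auto, metis last_in_set length_pawalk_verts length_0_conv nat.distinct(1))
  then show ?thesis
    using card_length[of "pawalk_verts i p"] card_distinct[of "pawalk_verts i p"]
    by (auto simp: length_pawalk_verts le_Suc_eq)
qed

section \<open>Powers of restricted matrices and Moebius inversion\<close>

lemma path_gf_Cons:
  "path_gf \<omega> ((i, k) # p) = fps_X * fps_const (\<omega> i k) * path_gf \<omega> p"
proof -
  have "path_gf \<omega> ((i, k) # p) = fps_const (\<omega> i k) * path_gf \<omega> p * fps_X"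
    by (simp add: path_gf_def path_label_def power_commutes mult.assoc flip: fps_const_mult)
  then show ?thesis
    by (simp only: fps_mult_fps_X_commute mult.assoc)
qed

text \<open>Split by the first arc. The right-hand index set need not demand
  \<open>k \<in> S\<close>: otherwise no walk from \<open>k\<close> stays in \<open>S\<close> and
  the image is empty.\<close>

lemma walks_Suc_within:
  "{p \<in> walks E i j (Suc m). set (pawalk_verts i p) \<subseteq> S} =
    (\<Union>k\<in>{k. (i, k) \<in> E \<and> i \<in> S}. (#) (i, k) ` {p \<in> walks E k j m. set (pawalk_verts k p) \<subseteq> S})"
  (is "?L = ?R")
proof
  show "?L \<subseteq> ?R"
  proof
    fix p assume "p \<in> ?L"
    then obtain k q where "p = (i, k) # q" by (cases p) (auto simp: walks_def)
    with \<open>p \<in> ?L\<close> show "p \<in> ?R" by (auto simp: walks_def)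
  qed
qed (auto simp: walks_def)

text \<open>Induction on the first arc. The assumption excludes just \<open>m = 0\<close> with
  \<open>i = j\<close> outside \<open>S\<close>, where the identity matrix has entry 1 but no empty
  walk lies in \<open>S\<close>.\<close>

lemma mat_pow_restrict_nth:
  fixes E :: "('n::finite \<times> 'n) set" and \<omega> :: "'n \<Rightarrow> 'n \<Rightarrow> 'a::ring_1"
  assumes "m > 0 \<or> i \<in> S \<or> i \<noteq> j"
  shows "mat_pow (z_times (restrict_mat (labeled_adjacency E \<omega>) S)) m $ i $ j =
    (\<Sum>p | p \<in> walks E i j m \<and> set (pawalk_verts i p) \<subseteq> S. path_gf \<omega> p)"
  using assms
proof (induction m arbitrary: i)
  case 0
  then have "{p \<in> walks E i j 0. set (pawalk_verts i p) \<subseteq> S} = (if i = j then {[]} else {})"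
    by (auto simp: walks_def)
  then show ?case by (simp add: mat_def path_gf_def path_label_def)
next
  case (Suc m)
  let ?A = "z_times (restrict_mat (labeled_adjacency E \<omega>) S)"
  let ?w = "\<lambda>k m. {p \<in> walks E k j m. set (pawalk_verts k p) \<subseteq> S}"
  have arc: "?A $ i $ k = (if (i, k) \<in> E \<and> i \<in> S \<and> k \<in> S
      then fps_X * fps_const (\<omega> i k) else 0)" for k
    by (simp add: z_times_def restrict_mat_def labeled_adjacency_def)
  have entry: "?A $ i $ k * mat_pow ?A m $ k $ j =
      (if (i, k) \<in> E \<and> i \<in> S then \<Sum>p\<in>?w k m. path_gf \<omega> ((i, k) # p) else 0)" for k
  proof (cases "(i, k) \<in> E \<and> i \<in> S \<and> k \<in> S")
    \<comment> \<open>Here \<open>k \<in> S\<close> supplies the assumption of the induction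
      hypothesis, even for \<open>m = 0\<close>.\<close>
    case True
    then show ?thesis
      by (simp add: Suc.IH arc path_gf_Cons sum_distrib_left)
  next
    case False
    have "(\<Sum>p\<in>?w k m. path_gf \<omega> ((i, k) # p)) = 0" if "k \<notin> S"
      using that by (intro sum.neutral) (auto simp: walks_def dest: start_in_pawalk_verts)
    with False show ?thesis
      by (auto simp: arc)
  qed
  have "(\<Sum>p\<in>?w i (Suc m). path_gf \<omega> p) =
      (\<Sum>k | (i, k) \<in> E \<and> i \<in> S. \<Sum>p\<in>(#) (i, k) ` ?w k m. path_gf \<omega> p)"
    unfolding walks_Suc_within by (rule sum.UNION_disjoint) (auto simp: finite_walks)
  also have "\<dots> = (\<Sum>k | (i, k) \<in> E \<and> i \<in> S. \<Sum>p\<in>?w k m. path_gf \<omega> ((i, k) # p))"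
    by (simp add: sum.reindex)
  also have "\<dots> = (\<Sum>k\<in>UNIV. ?A $ i $ k * mat_pow ?A m $ k $ j)"
    by (simp add: entry sum.If_cases)
  finally show ?case by (simp add: matrix_matrix_mult_def)
qed

lemma mobius_walks:
  fixes E :: "('n::finite \<times> 'n) set" and \<omega> :: "'n \<Rightarrow> 'n \<Rightarrow> 'a::ring_1"
  assumes "m > 0 \<or> i \<noteq> j"
  shows "(\<Sum>S\<in>Pow T - {{}}. (-1) ^ (card T - card S) *
      mat_pow (z_times (restrict_mat (labeled_adjacency E \<omega>) S)) m $ i $ j) =
    (\<Sum>p | p \<in> walks E i j m \<and> set (pawalk_verts i p) = T. path_gf \<omega> p)"
proof -
  let ?f = "\<lambda>T. \<Sum>p | p \<in> walks E i j m \<and> set (pawalk_verts i p) = T. path_gf \<omega> p"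
  let ?g = "\<lambda>S. \<Sum>p | p \<in> walks E i j m \<and> set (pawalk_verts i p) \<subseteq> S. path_gf \<omega> p"
  have "?g S = sum ?f (Pow S)" for S
  proof -
    have "{p. p \<in> walks E i j m \<and> set (pawalk_verts i p) \<subseteq> S} =
        (\<Union>T\<in>Pow S. {p. p \<in> walks E i j m \<and> set (pawalk_verts i p) = T})"
      by auto
    then show ?thesis
      by (simp only:) (rule sum.UNION_disjoint, auto simp: finite_walks)
  qed
  then have "?f T = (\<Sum>S\<in>Pow T. (-1) ^ (card T - card S) * ?g S)"
    by (intro inclusion_exclusion_mobius) auto
  \<comment> \<open>Moebius inversion ranges over all subsets; the empty one drops out because every
    walk has a vertex.\<close>
  also have "\<dots> = (\<Sum>S\<in>Pow T - {{}}. (-1) ^ (card T - card S) * ?g S)"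
  proof (rule sum.mono_neutral_right)
    have "set (pawalk_verts i p) \<noteq> {}" for p
      by (cases p) auto
    then show "\<forall>S\<in>Pow T - (Pow T - {{}}). (-1) ^ (card T - card S) * ?g S = 0"
      by auto
  qed auto
  also have "?g = (\<lambda>S. mat_pow (z_times (restrict_mat (labeled_adjacency E \<omega>) S)) m $ i $ j)"
    using assms by (intro ext mat_pow_restrict_nth[symmetric]) auto
  finally show ?thesis ..
qed

section \<open>Expansion over subsets and regrouping\<close>

lemma mat_pow_commute: "mat_pow A r ** A = A ** mat_pow A r"
  by (induction r) (simp_all add: matrix_mul_assoc[symmetric])

text \<open>A binomial expansion indexed by subsets rather than exponents: each \<open>U\<close> is
  the set of factors contributing \<open>- A\<close>. The exponent \<open>r\<close> varies in the
  induction because choosing \<open>- A\<close> raises it by one.\<close>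

lemma mat_pow_mult_one_minus_pow:
  fixes A :: "'a::ring_1^'n^'n"
  assumes "finite F"
  shows "(mat_pow A r ** mat_pow (mat 1 - A) (card F)) $ i $ j =
    (\<Sum>U\<in>Pow F. (-1) ^ card U * mat_pow A (r + card U) $ i $ j)"
  using assms
proof (induction F arbitrary: r)
  case empty
  then show ?case by simp
next
  case (insert x F)
  let ?B = "mat_pow (mat 1 - A) (card F)"
  let ?t = "\<lambda>r U. (-1) ^ card U * mat_pow A (r + card U) $ i $ j"
  have "mat_pow A r ** ((mat 1 - A) ** ?B) = (mat_pow A r ** (mat 1 - A)) ** ?B"
    by (rule matrix_mul_assoc)
  also have "mat_pow A r ** (mat 1 - A) = mat_pow A r - mat_pow A (Suc r)"
  proof -
    have "mat_pow A r ** (mat 1 - A) + mat_pow A r ** A = mat_pow A r"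
      by (simp flip: matrix_add_ldistrib)
    then show ?thesis by (simp add: mat_pow_commute algebra_simps)
  qed
  also have "(mat_pow A r - mat_pow A (Suc r)) ** ?B =
      mat_pow A r ** ?B - mat_pow A (Suc r) ** ?B"
    by (simp only: vec_eq_iff matrix_matrix_mult_def vector_minus_component vec_lambda_beta
        left_diff_distrib sum_subtractf simp_thms)
  finally have "(mat_pow A r ** mat_pow (mat 1 - A) (card (insert x F))) $ i $ j =
      sum (?t r) (Pow F) - sum (?t (Suc r)) (Pow F)"
    using insert by (simp del: mat_pow.simps add: mat_pow.simps(2)[of "mat 1 - A"])
  \<comment> \<open>The extra factor \<open>A\<close> is booked as the new element \<open>x\<close>
    of \<open>U\<close>, which flips the sign.\<close>
  also have "sum (?t (Suc r)) (Pow F) = - (\<Sum>U\<in>Pow F. ?t r (insert x U))"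
    unfolding sum_negf[symmetric]
  proof (rule sum.cong)
    fix U assume "U \<in> Pow F"
    then have "card (insert x U) = Suc (card U)"
      using insert.hyps by (subst card_insert_disjoint) (auto dest: finite_subset)
    then show "?t (Suc r) U = - ?t r (insert x U)" by simp
  qed simp
  also have "(\<Sum>U\<in>Pow F. ?t r (insert x U)) = sum (?t r) (insert x ` Pow F)"
    using insert.hyps by (subst sum.reindex) (auto simp: inj_on_def)
  also have "sum (?t r) (Pow F) - - sum (?t r) (insert x ` Pow F) =
      sum (?t r) (Pow (insert x F))"
    using insert.hyps unfolding Pow_insert by (subst sum.union_disjoint) auto
  finally show ?case .
qed

text \<open>The bijection sends \<open>(S, U)\<close> to \<open>(S \<union> U, S)\<close>; its
  inverse recovers \<open>U\<close> as \<open>T - S\<close>.\<close>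

lemma sum_disjoint_subsets:
  fixes g :: "'n::finite set \<Rightarrow> 'n set \<Rightarrow> 'b::comm_monoid_add"
  shows "(\<Sum>S | S \<noteq> {}. \<Sum>U\<in>Pow (- S). g S (S \<union> U)) =
    (\<Sum>T | T \<noteq> {}. \<Sum>S\<in>Pow T - {{}}. g S T)"
proof -
  have "(\<Sum>S | S \<noteq> {}. \<Sum>U\<in>Pow (- S). g S (S \<union> U)) =
      (\<Sum>(S, U)\<in>(SIGMA S:{S. S \<noteq> {}}. Pow (- S)). g S (S \<union> U))"
    by (rule sum.Sigma) auto
  also have "\<dots> = (\<Sum>(T, S)\<in>(SIGMA T:{T. T \<noteq> {}}. Pow T - {{}}). g S T)"
    by (rule sum.reindex_bij_witness[where j = "\<lambda>(S, U). (S \<union> U, S)"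
          and i = "\<lambda>(T, S). (S, T - S)"]) auto
  also have "\<dots> = (\<Sum>T | T \<noteq> {}. \<Sum>S\<in>Pow T - {{}}. g S T)"
    by (rule sum.Sigma[symmetric]) auto
  finally show ?thesis .
qed

lemma sum_mat_pow_regroup:
  fixes A :: "'n::finite set \<Rightarrow> 'a::ring_1^'n^'n"
  assumes "d \<le> 1"
  shows "(\<Sum>S | S \<noteq> {}. mat_pow (A S) (card S - d) ** mat_pow (mat 1 - A S) (CARD('n) - card S)) $ i $ j =
    (\<Sum>T | T \<noteq> {}. \<Sum>S\<in>Pow T - {{}}. (-1) ^ (card T - card S) * mat_pow (A S) (card T - d) $ i $ j)"
proof -
  have "(mat_pow (A S) (card S - d) ** mat_pow (mat 1 - A S) (CARD('n) - card S)) $ i $ j =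
      (\<Sum>U\<in>Pow (- S). (-1) ^ (card (S \<union> U) - card S) * mat_pow (A S) (card (S \<union> U) - d) $ i $ j)"
    if "S \<noteq> {}" for S
  proof -
    \<comment> \<open>This keeps the truncated subtraction exact, so that
      \<open>card S - d + card U\<close> equals \<open>card (S \<union> U) - d\<close>.\<close>
    have "card S \<ge> d"
      using assms that by (metis One_nat_def Suc_leI card_gt_0_iff finite le_trans)
    moreover have "card (S \<union> U) = card S + card U" if "U \<subseteq> - S" for U
      using that by (intro card_Un_disjoint) auto
    moreover have "CARD('n) - card S = card (- S)"
      by (simp add: Compl_eq_Diff_UNIV card_Diff_subset)
    ultimately show ?thesis
      by (simp add: mat_pow_mult_one_minus_pow)
  qed
  then show ?thesis
    by (simp add: sum_disjoint_subsets[where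
          g = "\<lambda>S T. (-1) ^ (card T - card S) * mat_pow (A S) (card T - d) $ i $ j"])
qed

section \<open>Assembling the two identities\<close>

lemma sum_walks_eq_simple_path_gf:
  fixes E :: "('n::finite \<times> 'n) set" and \<omega> :: "'n \<Rightarrow> 'n \<Rightarrow> 'a::ring_1"
  assumes "d = (if i = j then 0 else 1)"
  shows "(\<Sum>T | T \<noteq> {}. \<Sum>p | p \<in> walks E i j (card T - d) \<and> set (pawalk_verts i p) = T. path_gf \<omega> p) =
    simple_path_gf E \<omega> $ i $ j"
proof -
  have "set (pawalk_verts i p) \<noteq> {}" for p
    by (cases p) auto
  then have "simple_paths E i j =
      (\<Union>T\<in>{T. T \<noteq> {}}. {p. p \<in> walks E i j (card T - d) \<and> set (pawalk_verts i p) = T})"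
    unfolding simple_paths_eq_walks assms by auto
  then have "(\<Sum>p\<in>simple_paths E i j. path_gf \<omega> p) =
      (\<Sum>T | T \<noteq> {}. \<Sum>p | p \<in> walks E i j (card T - d) \<and> set (pawalk_verts i p) = T. path_gf \<omega> p)"
    by (simp only:) (rule sum.UNION_disjoint, auto simp: finite_walks)
  then show ?thesis by (simp add: simple_path_gf_def path_gf_def)
qed

lemma sum_mat_pow_eq_simple_path_gf:
  fixes E :: "('n::finite \<times> 'n) set" and \<omega> :: "'n \<Rightarrow> 'n \<Rightarrow> 'a::ring_1"
  defines "A \<equiv> \<lambda>S. z_times (restrict_mat (labeled_adjacency E \<omega>) S)"
  assumes d: "d = (if i = j then 0 else 1)"
  shows "(\<Sum>S | S \<noteq> {}. mat_pow (A S) (card S - d) ** mat_pow (mat 1 - A S) (CARD('n) - card S)) $ i $ j =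
    simple_path_gf E \<omega> $ i $ j"
proof -
  have "(\<Sum>S\<in>Pow T - {{}}. (-1) ^ (card T - card S) * mat_pow (A S) (card T - d) $ i $ j) =
      (\<Sum>p | p \<in> walks E i j (card T - d) \<and> set (pawalk_verts i p) = T. path_gf \<omega> p)"
    if "T \<noteq> {}" for T
    \<comment> \<open>For \<open>i = j\<close> the exponent is \<open>card T\<close>, hence
      positive; otherwise \<open>i \<noteq> j\<close> meets the other alternative.\<close>
    unfolding A_def using that d by (intro mobius_walks) (auto simp: card_gt_0_iff)
  then show ?thesis
    using d by (simp add: sum_mat_pow_regroup sum_walks_eq_simple_path_gf del: sum_component)
qed

text \<open>This isolates the correction term: each singleton \<open>T\<close> contributes 1 to
  every diagonal entry, and larger \<open>T\<close> contribute nothing.\<close>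

lemma sum_mat_pow_open_diagonal:
  fixes E :: "('n::finite \<times> 'n) set" and \<omega> :: "'n \<Rightarrow> 'n \<Rightarrow> 'a::ring_1"
  defines "A \<equiv> \<lambda>S. z_times (restrict_mat (labeled_adjacency E \<omega>) S)"
  shows "(\<Sum>S | S \<noteq> {}. mat_pow (A S) (card S - 1) ** mat_pow (mat 1 - A S) (CARD('n) - card S)) $ i $ i =
    of_nat CARD('n)"
proof -
  have "(\<Sum>S\<in>Pow T - {{}}. (-1) ^ (card T - card S) * mat_pow (A S) (card T - 1) $ i $ i) =
      (if card T = 1 then 1 else 0)" if "T \<noteq> {}" for T
  proof (cases "card T = 1")
    case True
    then obtain t where t: "T = {t}" by (auto simp: card_1_singleton_iff)
    have "Pow {t} - {{}} = {{t}}" by auto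
    \<comment> \<open>The zeroth power gives 1 at \<open>i\<close> even when
      \<open>i \<noteq> t\<close>, so all singletons count and not only \<open>{i}\<close>.\<close>
    then show ?thesis by (simp add: t mat_def)
  next
    case False
    have "card T > 0" using that by (simp add: card_gt_0_iff)
    with False have m: "card T - 1 > 0" by simp
    \<comment> \<open>A nonempty closed walk through all of \<open>T\<close> has at least
      \<open>card T\<close> arcs, one too many.\<close>
    have "{p. p \<in> walks E i i (card T - 1) \<and> set (pawalk_verts i p) = T} = {}"
    proof safe
      fix p assume p: "p \<in> walks E i i (card (set (pawalk_verts i p)) - 1)"
        and T: "T = set (pawalk_verts i p)"
      then show "p \<in> {}"
        using card_closed_walk_verts_le[of i p] m by (cases "p = []") (auto simp: walks_def)
    qed
    then have "(\<Sum>p | p \<in> walks E i i (card T - 1) \<and> set (pawalk_verts i p) = T. path_gf \<omega> p) = 0"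
      by (simp only: sum.empty)
    then show ?thesis
      using mobius_walks[of "card T - 1" i i T E \<omega>] m False by (simp add: A_def)
  qed
  then have "(\<Sum>S | S \<noteq> {}. mat_pow (A S) (card S - 1) ** mat_pow (mat 1 - A S) (CARD('n) - card S)) $ i $ i =
      (\<Sum>T | (T :: 'n set) \<noteq> {}. if card T = 1 then 1 else 0)"
    by (simp add: sum_mat_pow_regroup del: sum_component)
  also have "\<dots> = of_nat (card {T :: 'n set. T \<noteq> {} \<and> card T = 1})"
    by (simp add: sum.If_cases Int_def)
  also have "{T :: 'n set. T \<noteq> {} \<and> card T = 1} = range (\<lambda>x. {x})"
    by (auto simp: card_1_singleton_iff)
  also have "card \<dots> = CARD('n)"
    by (rule card_image) (simp add: inj_on_def)
  finally show ?thesis .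
qed

theorem proposition1:
  fixes E :: "('n::finite \<times> 'n) set"
    and \<omega> :: "'n \<Rightarrow> 'n \<Rightarrow> 'a::ring_1"
  shows
    "open_simple_path_gf E \<omega> =
      (\<Sum>S | S \<noteq> {}.
        mat_pow (z_times (restrict_mat (labeled_adjacency E \<omega>) S)) (card S - 1) **
        mat_pow (mat 1 - z_times (restrict_mat (labeled_adjacency E \<omega>) S)) (CARD('n) - card S))
      - mat (of_nat CARD('n))
    \<and>
    closed_simple_path_gf E \<omega> =
      (\<Sum>S | S \<noteq> {}.
        Diag (mat_pow (z_times (restrict_mat (labeled_adjacency E \<omega>) S)) (card S) **
          mat_pow (mat 1 - z_times (restrict_mat (labeled_adjacency E \<omega>) S)) (CARD('n) - card S)))"
proof
  let ?A = "\<lambda>S. z_times (restrict_mat (labeled_adjacency E \<omega>) S)"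
  let ?M = "\<lambda>d. \<Sum>S | S \<noteq> {}.
    mat_pow (?A S) (card S - d) ** mat_pow (mat 1 - ?A S) (CARD('n) - card S)"
  show "open_simple_path_gf E \<omega> = ?M 1 - mat (of_nat CARD('n))"
    unfolding vec_eq_iff
  proof (intro allI)
    fix i j
    show "open_simple_path_gf E \<omega> $ i $ j = (?M 1 - mat (of_nat CARD('n))) $ i $ j"
    proof (cases "i = j")
      case True
      then show ?thesis
        using sum_mat_pow_open_diagonal[of E \<omega> j]
        by (simp add: open_simple_path_gf_diagonal mat_def del: sum_component)
    next
      case False
      then show ?thesis
        using sum_mat_pow_eq_simple_path_gf[of 1 i j E \<omega>]
        by (simp add: open_simple_path_gf_def closed_simple_path_gf_def Diag_def mat_def
            del: sum_component)
    qed
  qed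
  \<comment> \<open>With \<open>d = 0\<close> the entrywise identity is available only on the
    diagonal, which is all that \<open>Diag\<close> retains.\<close>
  have "closed_simple_path_gf E \<omega> = Diag (?M 0)"
    using sum_mat_pow_eq_simple_path_gf[of 0 i i E \<omega> for i]
    by (simp add: closed_simple_path_gf_def Diag_def vec_eq_iff del: sum_component)
  also have "Diag (?M 0) = (\<Sum>S | S \<noteq> {}. Diag (mat_pow (?A S) (card S) **
      mat_pow (mat 1 - ?A S) (CARD('n) - card S)))"
    by (simp add: Diag_def vec_eq_iff)
  finally show "closed_simple_path_gf E \<omega> = \<dots>" .
qed

end
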